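(* Let $\beta\in[0,1]$. If $f\in\mathcal{A}_\beta$ has the form $f(z)=z+\sum_{n=2}^\infty a_n z^n$, then: (i) for every integer $n\ge 2$, $$|T_2(n)(f)|\le 4\left(\frac{1}{(n-\beta(n-1))^2}+\frac{1}{(n+1-n\beta)^2}\right);$$ (ii) $$|T_3(1)(f)|\le \frac{4\beta^4-28\beta^3+101\beta^2-196\beta+140}{(3-2\beta)^2(\beta-2)^2}.$$ The bounds are sharp.
   Context: $\mathbb{D}=\{z\in\mathbb{C}:|z|<1\}$. $\mathcal{A}$ is the class of holomorphic functions $f$ on $\mathbb{D}$ of the form $f(z)=z+\sum_{n=2}^\infty a_n z^n$. For $\beta\in[0,1]$, $\mathcal{A}_\beta=\{f\in\mathcal{A}:\operatorname{Re}(\beta \frac{f(z)}{z}+(1-\beta)f'(z))>0 \text{ for all } z\in\mathbb{D}\}$, where $f(z)/z$ takes the value $1$ at $z=0$. $T_m(n)(f)$ is the $m\times m$ symmetric Toeplitz determinant whose $(i,j)$ entry is $a_{n+|i-j|}$ (with $a_1=1$); in particular $T_2(n)(f)=a_n^2-a_{n+1}^2$ and $T_3(1)(f)=1-2a_2^2+2a_2^2a_3-a_3^2$. A bound being sharp means that equality is attained for some $f\in\mathcal{A}_\beta$. *)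

theory Defs
  imports "HOL-Complex_Analysis.Complex_Analysis" "Jordan_Normal_Form.Determinant"
begin

abbreviation unit_disc :: "complex set" ("\<D>")
  where "\<D> \<equiv> ball 0 1"

text \<open>Functions are total on the complex plane; only their values on the open unit disc matter.\<close>

definition class_A :: "(complex \<Rightarrow> complex) set" where
  "class_A = {f. f holomorphic_on \<D> \<and>
     (\<exists>c. \<forall>z\<in>\<D>. (\<lambda>n. c (n + 2) * z ^ (n + 2)) sums (f z - z))}"

definition class_A_beta :: "real \<Rightarrow> (complex \<Rightarrow> complex) set" where
  "class_A_beta \<beta> = {f \<in> class_A. \<forall>z\<in>\<D>.
     Re (of_real \<beta> * (if z = 0 then 1 else f z / z) + of_real (1 - \<beta>) * deriv f z) > 0}"

definition taylor_coeff :: "(complex \<Rightarrow> complex) \<Rightarrow> nat \<Rightarrow> complex" where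
  "taylor_coeff f n = fps_nth (fps_expansion f 0) n"

text \<open>
  The Toeplitz determinant \<open>T\<^sub>m(n)(f)\<close>. Rows and columns are numbered from \<open>0\<close>, which
  does not change \<open>\<bar>i - j\<bar>\<close>.
\<close>

definition toeplitz_det :: "nat \<Rightarrow> nat \<Rightarrow> (complex \<Rightarrow> complex) \<Rightarrow> complex" where
  "toeplitz_det m n f = Determinant.det
     (Matrix.mat m m (\<lambda>(i, j). taylor_coeff f (n + nat \<bar>int i - int j\<bar>)))"

text \<open>The coefficients of any expansion as in \<^const>\<open>class_A\<close> are the Taylor coefficients.\<close>

lemma taylor_coeff_eqI:
  assumes "\<forall>z\<in>\<D>. (\<lambda>n. c (n + 2) * z ^ (n + 2)) sums (f z - z)"
  shows "taylor_coeff f 0 = 0" "taylor_coeff f 1 = 1"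
    and "\<And>n. n \<ge> 2 \<Longrightarrow> taylor_coeff f n = c n"
proof -
  define F where "F = Abs_fps (\<lambda>n. if n = 0 then 0 else if n = 1 then 1 else c n)"
  have sums: "(\<lambda>n. fps_nth F n * z ^ n) sums f z" if "z \<in> \<D>" for z
  proof -
    have "(\<lambda>n. fps_nth F (n + 2) * z ^ (n + 2)) sums (f z - z)"
      using assms that by (simp add: F_def)
    moreover have "(\<Sum>i<2. fps_nth F i * z ^ i) = z"
      by (simp add: F_def numeral_2_eq_2)
    ultimately show ?thesis
      using sums_iff_shift[of "\<lambda>n. fps_nth F n * z ^ n" 2 "f z - z"] by simp
  qed
  have "conv_radius (fps_nth F) \<ge> norm (1/2 :: complex)"
    using sums[of "1/2"] by (intro conv_radius_geI) (auto simp: sums_iff)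
  moreover have "(0 :: ereal) < ereal (norm (1/2 :: complex))"
    by simp
  ultimately have "fps_conv_radius F > 0"
    unfolding fps_conv_radius_def by (rule less_le_trans[rotated])
  moreover have "eventually (\<lambda>z. eval_fps F z = f z) (nhds 0)"
    using eventually_nhds_in_open[of \<D> 0] sums
    by (auto elim!: eventually_mono simp: eval_fps_def sums_iff)
  ultimately have "f has_fps_expansion F"
    by (simp add: has_fps_expansion_def)
  then have "taylor_coeff f n = fps_nth F n" for n
    by (simp add: taylor_coeff_def fps_expansion_def fps_nth_fps_expansion)
  then show "taylor_coeff f 0 = 0" "taylor_coeff f 1 = 1"
    and "\<And>n. n \<ge> 2 \<Longrightarrow> taylor_coeff f n = c n"
    by (auto simp: F_def)
qed

lemma toeplitz_det_2:
  "toeplitz_det 2 n f = taylor_coeff f n ^ 2 - taylor_coeff f (n + 1) ^ 2"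
  unfolding toeplitz_det_def
  by (subst laplace_expansion_column[where n = 2 and j = 0])
     (auto simp: numeral_2_eq_2 cofactor_def mat_delete_def det_single power2_eq_square)

lemma toeplitz_det_3_1:
  assumes "f \<in> class_A"
  defines "a \<equiv> taylor_coeff f"
  shows "toeplitz_det 3 1 f = 1 - 2 * a 2 ^ 2 + 2 * a 2 ^ 2 * a 3 - a 3 ^ 2"
proof -
  have a1: "taylor_coeff f (Suc 0) = 1"
    using assms taylor_coeff_eqI(2) by (auto simp: class_A_def)
  have det2: "Determinant.det M = M $$ (0,0) * M $$ (1,1) - M $$ (0,1) * M $$ (1,0)"
    if "M \<in> carrier_mat 2 2" for M :: "complex Matrix.mat"
    using that
    by (subst laplace_expansion_column[where n = 2 and j = 0])
       (auto simp: numeral_2_eq_2 cofactor_def mat_delete_def det_single)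
  have "toeplitz_det 3 1 f =
     (\<Sum>i<3. Matrix.mat 3 3 (\<lambda>(i, j). taylor_coeff f (1 + nat \<bar>int i - int j\<bar>)) $$ (i, 0) *
        cofactor (Matrix.mat 3 3 (\<lambda>(i, j). taylor_coeff f (1 + nat \<bar>int i - int j\<bar>))) i 0)"
    unfolding toeplitz_det_def by (rule laplace_expansion_column) auto
  also have "\<dots> = 1 - 2 * a 2 ^ 2 + 2 * a 2 ^ 2 * a 3 - a 3 ^ 2"
    by (simp add: eval_nat_numeral cofactor_def mat_delete_def det2[unfolded numeral_2_eq_2]
        a_def a1 algebra_simps)
  finally show ?thesis .
qed

end

theory Submission
  imports Defs
begin

text \<open>
  For \<open>f\<close> of the class, the function \<open>p(z) = \<beta> f(z)/z + (1 - \<beta>) f'(z)\<close> has positive real part and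
  \<open>p(0) = 1\<close>, and comparing coefficients gives \<open>p\<^sub>n = (\<beta> + (1 - \<beta>)(n + 1)) a\<^bsub>n+1\<^esub>\<close>. Every estimate thus
  becomes an estimate for Caratheodory functions, whose coefficients satisfy \<open>\<bar>p\<^sub>k\<bar> \<le> 2\<close>
  (\<open>Caratheodory_coeff_bound\<close>). This yields (i) by the triangle inequality.

  For (ii) the triangle inequality applied to the four terms is too weak. Instead,
  \<open>T\<^sub>3(1)(f) = (1 - 2 a\<^sub>2\<^sup>2) - a\<^sub>3 (a\<^sub>3 - 2 a\<^sub>2\<^sup>2)\<close>, and the second factor is a
  Fekete-Szego functional: up to a constant it is \<open>p\<^sub>2 - \<mu> p\<^sub>1\<^sup>2\<close> with
  \<open>\<mu> = 2 (3 - 2 \<beta>) / (2 - \<beta>)\<^sup>2\<close>. On \<open>[0, 1]\<close> one has \<open>\<mu> \<ge> 1\<close>, and then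
  \<open>\<bar>p\<^sub>2 - \<mu> p\<^sub>1\<^sup>2\<bar> \<le> \<bar>p\<^sub>2 - p\<^sub>1\<^sup>2\<bar> + (\<mu> - 1) \<bar>p\<^sub>1\<bar>\<^sup>2 \<le> 2 + 4 (\<mu> - 1)\<close>, because \<open>p\<^sub>1\<^sup>2 - p\<^sub>2\<close> is itself a
  coefficient of the Caratheodory function \<open>1/p\<close>.

  All bounds are attained by one function, the one with \<open>p(z) = (1 + \<i> z) / (1 - \<i> z)\<close>, that is
  \<open>p\<^sub>k = 2 \<i>\<^sup>k\<close>: the squares of consecutive coefficients have opposite signs, and \<open>a\<^sub>2\<^sup>2\<close> and \<open>a\<^sub>3\<close> are both
  negative, so that no cancellation occurs in any of the triangle inequalities.
\<close>


section \<open>Coefficients of functions with positive real part\<close>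

text \<open>
  On a circle of radius \<open>r\<close>, Cauchy's formula represents \<open>2 \<pi> r\<^sup>k p\<^sub>k\<close> as the integral of
  \<open>p e\<^bsup>-ikt\<^esup>\<close>, while for \<open>k \<ge> 1\<close> Cauchy's theorem makes the integral of \<open>p e\<^bsup>ikt\<^esup>\<close> vanish. Adding the
  conjugate of the second integral to the first turns \<open>p\<close> into \<open>2 Re p\<close>. Since this is nonnegative, the
  integral is bounded by the integral of \<open>2 Re p\<close>, which the mean value property evaluates as
  \<open>4 \<pi> Re (p 0)\<close>. Then let \<open>r\<close> tend to 1.
\<close>
lemma Caratheodory_coeff_bound:
  assumes hol: "p holomorphic_on ball 0 1"
    and pos: "\<And>z. z \<in> ball 0 1 \<Longrightarrow> Re (p z) \<ge> 0"
    and k: "k \<ge> 1"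
  shows "norm (fps_nth (fps_expansion p 0) k) \<le> 2 * Re (p 0)"
proof -
  define c where "c = fps_nth (fps_expansion p 0) k"
  have bound: "norm c * r ^ k \<le> 2 * Re (p 0)" if r: "0 < r" "r < 1" for r :: real
  proof -
    define F where "F = (\<lambda>t. p (of_real r * cis t))"
    have in_disc: "of_real r * cis t \<in> ball 0 1" for t
      using r by (simp add: norm_mult)
    have hol_r: "p holomorphic_on ball 0 r" and cont_r: "continuous_on (cball 0 r) p"
      using r by (auto intro!: holomorphic_on_imp_continuous_on intro: holomorphic_on_subset[OF hol])
    have polar: "(g has_contour_integral I) (circlepath 0 r) \<longleftrightarrow>
        ((\<lambda>t. g (of_real r * cis t) * of_real r * \<i> * cis t) has_integral I) {0..2*pi}" for g I
      by (simp add: circlepath_def has_contour_integral_part_circlepath_iff)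
    (* Cauchy's formula; its case n = 0 is the mean value property *)
    have coeff: "((\<lambda>t. F t * cis (- real n * t)) has_integral
        2 * pi * of_real r ^ n * fps_nth (fps_expansion p 0) n) {0..2*pi}" for n
    proof -
      have "((\<lambda>u. p u / u ^ Suc n) has_contour_integral
          2 * pi * \<i> * fps_nth (fps_expansion p 0) n) (circlepath 0 r)"
        using Cauchy_has_contour_integral_higher_derivative_circlepath[OF cont_r hol_r, of 0 n] r
        by (simp add: fps_expansion_def field_simps)
      then have "((\<lambda>t. p (of_real r * cis t) / (of_real r * cis t) ^ Suc n * of_real r * \<i> * cis t)
          has_integral 2 * pi * \<i> * fps_nth (fps_expansion p 0) n) {0..2*pi}"
        by (simp only: polar)
      from has_integral_mult_right[OF this, of "of_real r ^ n / \<i>"]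
      have *: "((\<lambda>t. of_real r ^ n / \<i> * (p (of_real r * cis t) / (of_real r * cis t) ^ Suc n * of_real r * \<i> * cis t))
          has_integral 2 * pi * of_real r ^ n * fps_nth (fps_expansion p 0) n) {0..2*pi}"
        by (simp add: mult_ac)
      have "of_real r ^ n / \<i> * (p (of_real r * cis t) / (of_real r * cis t) ^ Suc n * of_real r * \<i> * cis t)
         = F t * cis (- real n * t)" for t
      proof -
        have "cis (- real n * t) = inverse (cis t ^ n)"
          by (simp add: Complex.DeMoivre)
        then show ?thesis
          using r by (simp add: F_def power_mult_distrib field_simps)
      qed
      with * show ?thesis by simp
    qed
    (* dt = du / (i u), so that the integral of p e^(ikt) is that of p u^(k - 1) *)
    have "((\<lambda>u. p u * u ^ (k - 1)) has_contour_integral 0) (circlepath 0 r)"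
      using r by (intro Cauchy_theorem_disc_simple[of _ 0 1] holomorphic_intros hol) auto
    then have "((\<lambda>t. p (of_real r * cis t) * (of_real r * cis t) ^ (k - 1) * of_real r * \<i> * cis t)
          has_integral 0) {0..2*pi}"
      by (simp only: polar)
    from has_integral_mult_right[OF this, of "1 / (\<i> * of_real r ^ k)"]
    have *: "((\<lambda>t. 1 / (\<i> * of_real r ^ k) *
          (p (of_real r * cis t) * (of_real r * cis t) ^ (k - 1) * of_real r * \<i> * cis t))
          has_integral 0) {0..2*pi}"
      by simp
    have "1 / (\<i> * of_real r ^ k) *
          (p (of_real r * cis t) * (of_real r * cis t) ^ (k - 1) * of_real r * \<i> * cis t)
        = F t * cis (real k * t)" for t
    proof -
      have "cis (real k * t) = cis t ^ (k - 1) * cis t"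
        using k by (simp only: Complex.DeMoivre[symmetric] power_minus_mult)
      moreover have "complex_of_real r ^ k = of_real r ^ (k - 1) * of_real r"
        using k by (simp flip: power_Suc2)
      ultimately show ?thesis
        using r by (simp add: F_def power_mult_distrib field_simps)
    qed
    with * have "((\<lambda>t. F t * cis (real k * t)) has_integral 0) {0..2*pi}" by simp
    then have "((\<lambda>t. cnj (F t) * cis (- real k * t)) has_integral 0) {0..2*pi}"
      by (subst (asm) has_integral_cnj[symmetric]) (simp add: o_def cis_cnj)
    from has_integral_add[OF coeff[of k] this]
    have Re_coeff: "((\<lambda>t. 2 * of_real (Re (F t)) * cis (- real k * t)) has_integral
        2 * pi * of_real r ^ k * c) {0..2*pi}"
      by (simp add: c_def complex_add_cnj flip: distrib_right)
    have Re_mean: "((\<lambda>t. 2 * Re (F t)) has_integral 2 * (2 * pi * Re (p 0))) {0..2*pi}"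
      using has_integral_Re[OF coeff[of 0]]
      by (intro has_integral_mult_right) (simp add: fps_expansion_def)
    have "norm (integral {0..2*pi} (\<lambda>t. 2 * of_real (Re (F t)) * cis (- real k * t)))
        \<le> integral {0..2*pi} (\<lambda>t. 2 * Re (F t))"
      using Re_coeff Re_mean pos[OF in_disc]
      by (intro integral_norm_bound_integral) (auto simp: F_def norm_mult has_integral_integrable)
    then have "norm (2 * pi * of_real r ^ k * c) \<le> 2 * (2 * pi * Re (p 0))"
      using Re_coeff Re_mean by (simp only: integral_unique)
    then show ?thesis
      using r by (simp add: norm_mult norm_power mult_ac)
  qed
  have "((\<lambda>r. norm c * r ^ k) \<longlongrightarrow> norm c * 1 ^ k) (at_left (1 :: real))"
    by (intro tendsto_intros)
  moreover have "eventually (\<lambda>r. norm c * r ^ k \<le> 2 * Re (p 0)) (at_left 1)"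
    using eventually_at_left_real[of 0 "1 :: real"] by (auto elim!: eventually_mono intro: bound)
  ultimately have "norm c * 1 ^ k \<le> 2 * Re (p 0)"
    by (rule tendsto_upperbound) simp
  then show ?thesis by (simp add: c_def)
qed

text \<open>
  \<open>1/p\<close> again has positive real part and value 1 at 0, and its second coefficient is
  \<open>p\<^sub>1\<^sup>2 - p\<^sub>2\<close>.
\<close>
lemma Caratheodory_second_coeff_inverse_bound:
  assumes hol: "p holomorphic_on ball 0 1"
    and pos: "\<And>z. z \<in> ball 0 1 \<Longrightarrow> Re (p z) > 0"
    and p0: "p 0 = 1"
  defines "P \<equiv> fps_expansion p 0"
  shows "norm (fps_nth P 2 - fps_nth P 1 ^ 2) \<le> 2"
proof -
  define q where "q = (\<lambda>z. inverse (p z))"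
  define Q where "Q = fps_expansion q 0"
  have nz: "p z \<noteq> 0" if "z \<in> ball 0 1" for z
    using pos[OF that] by auto
  have hol_q: "q holomorphic_on ball 0 1"
    unfolding q_def by (intro holomorphic_intros hol nz)
  have "Re (q z) \<ge> 0" if "z \<in> ball 0 1" for z
    using pos[OF that] by (simp add: q_def)
  from Caratheodory_coeff_bound[OF hol_q this, of 2]
  have "norm (fps_nth Q 2) \<le> 2"
    by (simp add: Q_def q_def p0)
  moreover have "P * Q = 1"
  proof (rule fps_expansion_unique_complex)
    have "p has_fps_expansion P" "q has_fps_expansion Q"
      unfolding P_def Q_def
      by (rule has_fps_expansion_fps_expansion[where A = "ball 0 1"]; use hol hol_q in simp)+
    then show "(\<lambda>z. p z * q z) has_fps_expansion P * Q"
      by (rule has_fps_expansion_mult)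
    have "eventually (\<lambda>z. (1 :: complex) = p z * q z) (nhds 0)"
      using eventually_nhds_in_open[of "ball 0 1" "0 :: complex"] nz
      by (auto elim!: eventually_mono simp: q_def)
    then show "(\<lambda>z. p z * q z) has_fps_expansion 1"
      by (subst has_fps_expansion_cong[OF _ refl, where g = "\<lambda>_. 1"])
         (auto elim: eventually_mono)
  qed
  then have "fps_nth (P * Q) i = fps_nth 1 i" for i by simp
  from this[of 0] this[of 1] this[of 2]
  have "fps_nth P 0 * fps_nth Q 0 = 1"
    "fps_nth P 0 * fps_nth Q 1 + fps_nth P 1 * fps_nth Q 0 = 0"
    "fps_nth P 0 * fps_nth Q 2 + fps_nth P 1 * fps_nth Q 1 + fps_nth P 2 * fps_nth Q 0 = 0"
    by (simp_all add: fps_mult_nth numeral_2_eq_2)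
  moreover have "fps_nth P 0 = 1"
    by (simp add: P_def fps_expansion_def p0)
  ultimately have Q: "fps_nth Q 0 = 1" "fps_nth Q 1 = - fps_nth P 1"
    "fps_nth Q 2 + fps_nth P 1 * fps_nth Q 1 + fps_nth P 2 = 0"
    by (simp_all add: eq_neg_iff_add_eq_0)
  from Q(3) have "fps_nth Q 2 = fps_nth P 1 ^ 2 - fps_nth P 2"
    unfolding Q(2) by (simp add: power2_eq_square algebra_simps add_eq_0_iff)
  with \<open>norm (fps_nth Q 2) \<le> 2\<close> show ?thesis
    by (simp add: norm_minus_commute)
qed

text \<open>
  For \<open>\<mu> \<ge> 1\<close> split off \<open>p\<^sub>2 - p\<^sub>1\<^sup>2\<close>; the remainder \<open>(\<mu> - 1) p\<^sub>1\<^sup>2\<close> has size at most \<open>4 (\<mu> - 1)\<close>. The bound is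
  attained by \<open>p(z) = (1 + z) / (1 - z)\<close>.
\<close>
lemma Fekete_Szego_Caratheodory:
  fixes \<mu> :: real
  assumes hol: "p holomorphic_on ball 0 1"
    and pos: "\<And>z. z \<in> ball 0 1 \<Longrightarrow> Re (p z) > 0"
    and p0: "p 0 = 1" and \<mu>: "\<mu> \<ge> 1"
  defines "P \<equiv> fps_expansion p 0"
  shows "norm (fps_nth P 2 - of_real \<mu> * fps_nth P 1 ^ 2) \<le> 2 * (2 * \<mu> - 1)"
proof -
  have P1: "norm (fps_nth P 1) \<le> 2"
    using Caratheodory_coeff_bound[OF hol, of 1] pos p0 by (simp add: P_def less_imp_le)
  have "norm (fps_nth P 2 - of_real \<mu> * fps_nth P 1 ^ 2)
      = norm ((fps_nth P 2 - fps_nth P 1 ^ 2) - of_real (\<mu> - 1) * fps_nth P 1 ^ 2)"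
    by (simp add: algebra_simps)
  also have "\<dots> \<le> norm (fps_nth P 2 - fps_nth P 1 ^ 2) + norm (of_real (\<mu> - 1) * fps_nth P 1 ^ 2)"
    by (rule norm_triangle_ineq4)
  also have "norm (of_real (\<mu> - 1) * fps_nth P 1 ^ 2) = (\<mu> - 1) * norm (fps_nth P 1) ^ 2"
    using \<mu> by (simp add: norm_mult norm_power del: of_real_diff)
  also have "\<dots> \<le> (\<mu> - 1) * 2 ^ 2"
    using \<mu> P1 by (intro mult_left_mono power_mono) auto
  also have "norm (fps_nth P 2 - fps_nth P 1 ^ 2) \<le> 2"
    unfolding P_def by (rule Caratheodory_second_coeff_inverse_bound[OF hol pos p0])
  finally show ?thesis by simp
qed


section \<open>Passing from the class to functions with positive real part\<close>

definition beta_mean :: "real \<Rightarrow> (complex \<Rightarrow> complex) \<Rightarrow> complex \<Rightarrow> complex" where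
  "beta_mean \<beta> f z =
     of_real \<beta> * (if z = 0 then 1 else f z / z) + of_real (1 - \<beta>) * deriv f z"

lemma class_A_taylor_coeff:
  assumes "f \<in> class_A"
  shows "taylor_coeff f 0 = 0" "taylor_coeff f 1 = 1"
  using assms taylor_coeff_eqI(1,2) by (auto simp: class_A_def)

lemma class_A_value_at_0:
  assumes "f \<in> class_A"
  shows "f 0 = 0" "deriv f 0 = 1"
  using class_A_taylor_coeff[OF assms] by (auto simp: taylor_coeff_def fps_expansion_def)

lemma beta_mean_0:
  assumes "f \<in> class_A"
  shows "beta_mean \<beta> f 0 = 1"
  using class_A_value_at_0[OF assms] by (simp add: beta_mean_def)

lemma beta_mean_holomorphic:
  assumes f: "f \<in> class_A"
  shows "beta_mean \<beta> f holomorphic_on ball 0 1"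
proof -
  have hol: "f holomorphic_on ball 0 1"
    using f by (simp add: class_A_def)
  have "(\<lambda>z. if z = 0 then deriv f 0 else (f z - f 0) / (z - 0)) holomorphic_on ball 0 1"
    by (rule pole_lemma_open[OF hol open_ball])
  then have "(\<lambda>z. if z = 0 then 1 else f z / z) holomorphic_on ball 0 1"
    using class_A_value_at_0[OF f] by (simp cong: if_cong)
  then show ?thesis
    unfolding beta_mean_def
    by (intro holomorphic_intros holomorphic_deriv[OF hol] open_ball) auto
qed

text \<open>
  After multiplication by \<open>z\<close> the quotient disappears, and \<open>z p(z) = \<beta> f(z) + (1 - \<beta>) z f'(z)\<close> can be
  compared coefficientwise. The weight of \<open>a\<^sub>m\<close>, for \<open>m = n + 1\<close>, is \<open>\<beta> + (1 - \<beta>) m = m - \<beta> (m - 1)\<close>.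
\<close>
lemma beta_mean_coeff:
  assumes f: "f \<in> class_A"
  shows "fps_nth (fps_expansion (beta_mean \<beta> f) 0) n
       = of_real (\<beta> + (1 - \<beta>) * (real n + 1)) * taylor_coeff f (n + 1)"
proof -
  define F where "F = fps_expansion f 0"
  define P where "P = fps_expansion (beta_mean \<beta> f) 0"
  have hol: "f holomorphic_on ball 0 1"
    using f by (simp add: class_A_def)
  have F: "f has_fps_expansion F" and P: "beta_mean \<beta> f has_fps_expansion P"
    unfolding F_def P_def
    by (rule has_fps_expansion_fps_expansion[where A = "ball 0 1"];
        use hol beta_mean_holomorphic[OF f] in simp)+
  have "fps_X * P = fps_const (of_real \<beta>) * F + fps_const (of_real (1 - \<beta>)) * (fps_X * fps_deriv F)"
  proof (rule fps_expansion_unique_complex)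
    show "(\<lambda>z. z * beta_mean \<beta> f z) has_fps_expansion fps_X * P"
      by (intro fps_expansion_intros P)
    have split: "(\<lambda>z. z * beta_mean \<beta> f z) = (\<lambda>z. of_real \<beta> * f z + of_real (1 - \<beta>) * (z * deriv f z))"
      using class_A_value_at_0[OF f] by (auto simp: beta_mean_def fun_eq_iff algebra_simps)
    show "(\<lambda>z. z * beta_mean \<beta> f z) has_fps_expansion
        fps_const (of_real \<beta>) * F + fps_const (of_real (1 - \<beta>)) * (fps_X * fps_deriv F)"
      unfolding split by (intro fps_expansion_intros F)
  qed
  then have "fps_nth (fps_X * P) (Suc n) = fps_nth (fps_const (of_real \<beta>) * F +
      fps_const (of_real (1 - \<beta>)) * (fps_X * fps_deriv F)) (Suc n)"
    by simp
  then show ?thesis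
    by (simp add: P_def F_def taylor_coeff_def algebra_simps)
qed

lemma class_A_beta_iff:
  "f \<in> class_A_beta \<beta> \<longleftrightarrow> f \<in> class_A \<and> (\<forall>z\<in>ball 0 1. Re (beta_mean \<beta> f z) > 0)"
  by (simp add: class_A_beta_def beta_mean_def)

lemma beta_weight_ge_1:
  fixes \<beta> :: real
  assumes "\<beta> \<le> 1" "n \<ge> 1"
  shows "real n - \<beta> * (real n - 1) \<ge> 1"
proof -
  have "0 \<le> (1 - \<beta>) * (real n - 1)" using assms by simp
  then show ?thesis by (simp add: algebra_simps)
qed

lemma class_A_beta_coeff_bound:
  assumes \<beta>: "\<beta> \<le> 1" and f: "f \<in> class_A_beta \<beta>" and n: "n \<ge> 2"
  shows "norm (taylor_coeff f n) \<le> 2 / (real n - \<beta> * (real n - 1))"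
proof -
  define w where "w = real n - \<beta> * (real n - 1)"
  have w: "w \<ge> 1" unfolding w_def using \<beta> n by (intro beta_weight_ge_1) auto
  have f': "f \<in> class_A" and pos: "\<And>z. z \<in> ball 0 1 \<Longrightarrow> Re (beta_mean \<beta> f z) > 0"
    using f by (auto simp: class_A_beta_iff)
  have "norm (fps_nth (fps_expansion (beta_mean \<beta> f) 0) (n - 1)) \<le> 2 * Re (beta_mean \<beta> f 0)"
    using n by (intro Caratheodory_coeff_bound beta_mean_holomorphic f' less_imp_le[OF pos]) auto
  also have "fps_nth (fps_expansion (beta_mean \<beta> f) 0) (n - 1) = of_real w * taylor_coeff f n"
    using n by (simp add: beta_mean_coeff[OF f'] w_def of_nat_diff algebra_simps)
  finally have "w * norm (taylor_coeff f n) \<le> 2"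
    using w by (simp add: norm_mult beta_mean_0[OF f'])
  then show ?thesis
    unfolding w_def[symmetric] using w by (simp add: field_simps)
qed


section \<open>Upper bounds for the Toeplitz determinants\<close>

lemma toeplitz_2_bound:
  assumes \<beta>: "\<beta> \<le> 1" and f: "f \<in> class_A_beta \<beta>" and n: "n \<ge> 2"
  shows "norm (toeplitz_det 2 n f) \<le>
     4 * (1 / (real n - \<beta> * (real n - 1))\<^sup>2 + 1 / (real n + 1 - real n * \<beta>)\<^sup>2)"
proof -
  have "norm (toeplitz_det 2 n f) \<le> norm (taylor_coeff f n) ^ 2 + norm (taylor_coeff f (n + 1)) ^ 2"
    unfolding toeplitz_det_2 by (metis norm_triangle_ineq4 norm_power)
  also have "\<dots> \<le> (2 / (real n - \<beta> * (real n - 1))) ^ 2 +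
      (2 / (real (n + 1) - \<beta> * (real (n + 1) - 1))) ^ 2"
    using n by (intro add_mono power_mono class_A_beta_coeff_bound[OF \<beta> f]) auto
  also have "\<dots> = 4 * (1 / (real n - \<beta> * (real n - 1))\<^sup>2 + 1 / (real n + 1 - real n * \<beta>)\<^sup>2)"
    by (simp add: power_divide algebra_simps)
  finally show ?thesis .
qed

text \<open>
  The left-hand side is what \<open>\<bar>1 - 2 a\<^sub>2\<^sup>2\<bar> + \<bar>a\<^sub>3\<bar> \<bar>a\<^sub>3 - 2 a\<^sub>2\<^sup>2\<bar>\<close> becomes when each of the three moduli
  is replaced by its largest value.
\<close>
lemma toeplitz_3_bound_split:
  fixes \<beta> :: real
  assumes "0 \<le> \<beta>" "\<beta> \<le> 1"
  shows "1 + 8 / (2 - \<beta>)\<^sup>2 + 2 / (3 - 2 * \<beta>) * (8 / (2 - \<beta>)\<^sup>2 - 2 / (3 - 2 * \<beta>)) =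
     (4 * \<beta> ^ 4 - 28 * \<beta> ^ 3 + 101 * \<beta>\<^sup>2 - 196 * \<beta> + 140) / ((3 - 2 * \<beta>)\<^sup>2 * (\<beta> - 2)\<^sup>2)"
proof -
  have sq: "(\<beta> - 2)\<^sup>2 = (2 - \<beta>)\<^sup>2" by (rule power2_commute)
  define u v where "u = 2 - \<beta>" and "v = 3 - 2 * \<beta>"
  have nz: "u \<noteq> 0" "v \<noteq> 0" using assms by (auto simp: u_def v_def)
  have "1 + 8 / u\<^sup>2 + 2 / v * (8 / u\<^sup>2 - 2 / v) = (u\<^sup>2 * v\<^sup>2 + 8 * v\<^sup>2 + 16 * v - 4 * u\<^sup>2) / (v\<^sup>2 * u\<^sup>2)"
    using nz by (simp add: divide_simps power2_eq_square) (simp add: algebra_simps)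
  also have "u\<^sup>2 * v\<^sup>2 + 8 * v\<^sup>2 + 16 * v - 4 * u\<^sup>2
      = 4 * \<beta> ^ 4 - 28 * \<beta> ^ 3 + 101 * \<beta>\<^sup>2 - 196 * \<beta> + 140"
    by (simp add: u_def v_def eval_nat_numeral algebra_simps)
  finally show ?thesis by (simp only: u_def v_def sq)
qed

text \<open>
  Grouping the determinant as \<open>(1 - 2 a\<^sub>2\<^sup>2) - a\<^sub>3 (a\<^sub>3 - 2 a\<^sub>2\<^sup>2)\<close> loses nothing: the three quantities
  \<open>\<bar>1 - 2 a\<^sub>2\<^sup>2\<bar>\<close>, \<open>\<bar>a\<^sub>3\<bar>\<close> and \<open>\<bar>a\<^sub>3 - 2 a\<^sub>2\<^sup>2\<bar>\<close> are maximal for the same function.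
\<close>
lemma toeplitz_3_bound:
  assumes \<beta>: "0 \<le> \<beta>" "\<beta> \<le> 1" and f: "f \<in> class_A_beta \<beta>"
  shows "norm (toeplitz_det 3 1 f) \<le>
     (4 * \<beta> ^ 4 - 28 * \<beta> ^ 3 + 101 * \<beta>\<^sup>2 - 196 * \<beta> + 140) / ((3 - 2 * \<beta>)\<^sup>2 * (\<beta> - 2)\<^sup>2)"
proof -
  define u v where "u = 2 - \<beta>" and "v = 3 - 2 * \<beta>"
  define a2 a3 where "a2 = taylor_coeff f 2" and "a3 = taylor_coeff f 3"
  define P where "P = fps_expansion (beta_mean \<beta> f) 0"
  (* the parameter for which P_2 - mu P_1^2 is a multiple of a_3 - 2 a_2^2 *)
  define \<mu> where "\<mu> = 2 * v / u\<^sup>2"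
  have uv: "u > 0" "v > 0" using \<beta> by (auto simp: u_def v_def)
  have f': "f \<in> class_A" and pos: "\<And>z. z \<in> ball 0 1 \<Longrightarrow> Re (beta_mean \<beta> f z) > 0"
    using f by (auto simp: class_A_beta_iff)
  have "\<mu> \<ge> 1"
  proof -
    have "\<beta>\<^sup>2 \<le> 1" using \<beta> by (simp add: power_le_one)
    moreover have "2 * v - u\<^sup>2 = 2 - \<beta>\<^sup>2"
      by (simp add: u_def v_def power2_eq_square algebra_simps)
    ultimately show ?thesis using uv by (simp add: \<mu>_def)
  qed
  have P1: "fps_nth P 1 = of_real u * a2" and P2: "fps_nth P 2 = of_real v * a3"
    by (simp_all add: P_def u_def v_def a2_def a3_def beta_mean_coeff[OF f'] eval_nat_numeral algebra_simps)
  have a2: "norm a2 \<le> 2 / u" and a3: "norm a3 \<le> 2 / v"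
    using class_A_beta_coeff_bound[OF \<beta>(2) f, of 2] class_A_beta_coeff_bound[OF \<beta>(2) f, of 3]
    by (simp_all add: a2_def a3_def u_def v_def mult.commute)
  have "norm (fps_nth P 2 - of_real \<mu> * fps_nth P 1 ^ 2) \<le> 2 * (2 * \<mu> - 1)"
    unfolding P_def
    by (rule Fekete_Szego_Caratheodory[OF beta_mean_holomorphic[OF f'] pos beta_mean_0[OF f'] \<open>\<mu> \<ge> 1\<close>])
  also have "fps_nth P 2 - of_real \<mu> * fps_nth P 1 ^ 2 = of_real v * (a3 - 2 * a2\<^sup>2)"
    using uv unfolding P1 P2 by (simp add: \<mu>_def power_mult_distrib field_simps)
  finally have FS: "norm (a3 - 2 * a2\<^sup>2) \<le> 8 / u\<^sup>2 - 2 / v"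
    using uv unfolding norm_mult by (simp add: \<mu>_def divide_simps) (simp add: algebra_simps)
  have "toeplitz_det 3 1 f = (1 - 2 * a2\<^sup>2) - a3 * (a3 - 2 * a2\<^sup>2)"
    unfolding toeplitz_det_3_1[OF f'] by (simp add: a2_def a3_def power2_eq_square algebra_simps)
  also have "norm \<dots> \<le> norm (1 - 2 * a2\<^sup>2) + norm a3 * norm (a3 - 2 * a2\<^sup>2)"
    by (metis norm_triangle_ineq4 norm_mult)
  also have "norm (1 - 2 * a2\<^sup>2) \<le> 1 + 2 * (norm a2)\<^sup>2"
    using norm_triangle_ineq4[of 1 "2 * a2\<^sup>2"] by (simp add: norm_mult norm_power)
  also have "(norm a2)\<^sup>2 \<le> (2 / u)\<^sup>2"
    by (intro power_mono a2) auto
  also have "norm a3 * norm (a3 - 2 * a2\<^sup>2) \<le> 2 / v * (8 / u\<^sup>2 - 2 / v)"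
    using uv by (intro mult_mono a3 FS) auto
  finally have "norm (toeplitz_det 3 1 f) \<le> 1 + 8 / u\<^sup>2 + 2 / v * (8 / u\<^sup>2 - 2 / v)"
    by (simp add: power_divide)
  then show ?thesis
    unfolding u_def v_def by (simp only: toeplitz_3_bound_split[OF \<beta>])
qed


section \<open>The extremal function\<close>

text \<open>
  The coefficients are \<open>p\<^bsub>n-1\<^esub> / (n - \<beta> (n - 1))\<close> with \<open>p\<^sub>k = 2 \<i>\<^sup>k\<close>, the coefficients of
  \<open>(1 + \<i> z) / (1 - \<i> z)\<close> for \<open>k \<ge> 1\<close>. The factor 2 is absent for \<open>n = 1\<close> since \<open>p\<^sub>0 = 1\<close>.
\<close>
definition extremal_fps :: "real \<Rightarrow> complex fps" where
  "extremal_fps \<beta> = Abs_fps (\<lambda>n. if n = 0 then 0 else if n = 1 then 1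
     else 2 * \<i> ^ (n - 1) / of_real (real n - \<beta> * (real n - 1)))"

lemma fps_conv_radius_extremal_fps:
  assumes \<beta>: "\<beta> \<le> 1"
  shows "fps_conv_radius (extremal_fps \<beta>) \<ge> 1"
  unfolding fps_conv_radius_def
proof (rule conv_radius_geI_ex')
  fix r :: real
  assume r: "0 < r" "ereal r < 1"
  have "norm (fps_nth (extremal_fps \<beta>) n) \<le> 2" for n
  proof (cases "n < 2")
    case False
    define w where "w = real n - \<beta> * (real n - 1)"
    have "w \<ge> 1" unfolding w_def using False by (intro beta_weight_ge_1 \<beta>) auto
    then have "norm (2 * \<i> ^ (n - 1) / complex_of_real w) \<le> 2"
      by (simp add: norm_divide norm_mult norm_power field_simps)
    then show ?thesis using False by (simp add: extremal_fps_def w_def)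
  qed (auto simp: extremal_fps_def less_2_cases_iff)
  then have "norm (fps_nth (extremal_fps \<beta>) n * of_real r ^ n) \<le> 2 * r ^ n" for n
    using r by (simp add: norm_mult norm_power mult_right_mono)
  moreover have "summable (\<lambda>n. 2 * r ^ n)"
    using r by (intro summable_mult summable_geometric) (auto simp: one_ereal_def)
  ultimately show "summable (\<lambda>n. fps_nth (extremal_fps \<beta>) n * of_real r ^ n)"
    by (rule summable_comparison_test'[rotated, where N = 0])
qed

lemma eval_fps_in_class_A:
  assumes R: "fps_conv_radius F \<ge> 1" and F: "fps_nth F 0 = 0" "fps_nth F 1 = 1"
  shows "eval_fps F \<in> class_A" "taylor_coeff (eval_fps F) n = fps_nth F n"
proof -
  have "eval_fps F holomorphic_on ball 0 1"
  proof (intro holomorphic_on_eval_fps subsetI)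
    fix z :: complex
    assume "z \<in> ball 0 1"
    then show "z \<in> eball 0 (fps_conv_radius F)"
      using less_le_trans[OF _ R, of "ereal (norm z)"] by (simp add: one_ereal_def)
  qed
  moreover have sums: "(\<lambda>n. fps_nth F (n + 2) * z ^ (n + 2)) sums (eval_fps F z - z)"
    if "z \<in> ball 0 1" for z
  proof -
    have "ereal (norm z) < fps_conv_radius F"
      using that R by (intro less_le_trans[OF _ R]) (simp add: one_ereal_def)
    then have "(\<lambda>n. fps_nth F n * z ^ n) sums eval_fps F z"
      by (rule sums_eval_fps)
    then have "(\<lambda>n. fps_nth F (n + 2) * z ^ (n + 2)) sums (eval_fps F z - (\<Sum>i<2. fps_nth F i * z ^ i))"
      by (rule sums_split_initial_segment)
    moreover have "(\<Sum>i<2. fps_nth F i * z ^ i) = z"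
      using F by (simp add: numeral_2_eq_2)
    ultimately show ?thesis by simp
  qed
  ultimately show "eval_fps F \<in> class_A"
    unfolding class_A_def by blast
  show "taylor_coeff (eval_fps F) n = fps_nth F n"
    using taylor_coeff_eqI[of "fps_nth F" "eval_fps F"] sums F
    by (cases "n < 2") (auto simp: less_2_cases_iff)
qed

lemma Re_Moebius_pos:
  assumes "norm (u :: complex) < 1"
  shows "Re ((1 + u) / (1 - u)) > 0"
proof -
  have "u \<noteq> 1" using assms by auto
  have "(cmod u)\<^sup>2 < 1"
    using assms by (simp add: abs_square_less_1)
  then have "0 < (1 + Re u) * (1 - Re u) - Im u * Im u"
    by (simp add: cmod_def power2_eq_square algebra_simps)
  moreover have "(1 - Re u)\<^sup>2 + (Im u)\<^sup>2 > 0"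
    using \<open>u \<noteq> 1\<close> by (auto simp: sum_power2_gt_zero_iff complex_eq_iff)
  ultimately show ?thesis
    by (simp add: Re_divide)
qed

definition extremal :: "real \<Rightarrow> complex \<Rightarrow> complex" where
  "extremal \<beta> = eval_fps (extremal_fps \<beta>)"

lemma extremal_class_A:
  assumes \<beta>: "\<beta> \<le> 1"
  shows "extremal \<beta> \<in> class_A"
    "n \<ge> 2 \<Longrightarrow> taylor_coeff (extremal \<beta>) n = 2 * \<i> ^ (n - 1) / of_real (real n - \<beta> * (real n - 1))"
  unfolding extremal_def
  by (subst eval_fps_in_class_A | simp add: extremal_fps_def fps_conv_radius_extremal_fps[OF \<beta>, unfolded extremal_fps_def])+

text \<open>
  The weights cancel the denominators, which leaves \<open>1 + 2 u + 2 u\<^sup>2 + \<dots>\<close> with \<open>u = \<i> z\<close>.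
\<close>
lemma beta_mean_extremal:
  assumes \<beta>: "\<beta> \<le> 1" and z: "norm z < 1"
  shows "beta_mean \<beta> (extremal \<beta>) z = (1 + \<i> * z) / (1 - \<i> * z)"
proof -
  define P where "P = fps_expansion (beta_mean \<beta> (extremal \<beta>)) 0"
  have f: "extremal \<beta> \<in> class_A" by (rule extremal_class_A[OF \<beta>])
  have P0: "fps_nth P 0 = 1"
    by (simp add: P_def fps_expansion_def beta_mean_0[OF f])
  have P: "fps_nth P (Suc n) = 2 * \<i> ^ Suc n" for n
  proof -
    have "fps_nth P (Suc n) = of_real (\<beta> + (1 - \<beta>) * (real (Suc n) + 1)) * taylor_coeff (extremal \<beta>) (Suc n + 1)"
      unfolding P_def by (rule beta_mean_coeff[OF f])
    also have "\<beta> + (1 - \<beta>) * (real (Suc n) + 1) = real (Suc n + 1) - \<beta> * (real (Suc n + 1) - 1)"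
      by (simp add: algebra_simps)
    also have "taylor_coeff (extremal \<beta>) (Suc n + 1) = 
        2 * \<i> ^ (Suc n + 1 - 1) / of_real (real (Suc n + 1) - \<beta> * (real (Suc n + 1) - 1))"
      by (rule extremal_class_A[OF \<beta>]) simp
    finally show ?thesis
      using beta_weight_ge_1[OF \<beta>, of "Suc n + 1"] by (simp del: of_real_diff of_nat_Suc of_nat_add)
  qed
  have norm_iz: "norm (\<i> * z) < 1" using z by (simp add: norm_mult)
  have "beta_mean \<beta> (extremal \<beta>) has_fps_expansion P"
    unfolding P_def
    by (rule has_fps_expansion_fps_expansion[where A = "ball 0 1"])
       (use beta_mean_holomorphic[OF f] in simp_all)
  then have "(\<lambda>n. fps_nth P n * z ^ n) sums beta_mean \<beta> (extremal \<beta>) z"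
    by (rule has_fps_expansion_imp_sums_complex[where r = 1])
       (use z beta_mean_holomorphic[OF f] in \<open>simp_all add: one_ereal_def\<close>)
  then have "(\<lambda>n. fps_nth P (Suc n) * z ^ Suc n) sums (beta_mean \<beta> (extremal \<beta>) z - 1)"
    by (subst sums_Suc_iff) (simp add: P0)
  moreover have "(\<lambda>n. 2 * (\<i> * z) * (\<i> * z) ^ n) sums (2 * (\<i> * z) * (1 / (1 - \<i> * z)))"
    by (intro sums_mult geometric_sums norm_iz)
  then have "(\<lambda>n. fps_nth P (Suc n) * z ^ Suc n) sums (2 * (\<i> * z) * (1 / (1 - \<i> * z)))"
    by (simp add: P power_mult_distrib mult_ac)
  ultimately have "beta_mean \<beta> (extremal \<beta>) z - 1 = 2 * (\<i> * z) * (1 / (1 - \<i> * z))"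
    by (rule sums_unique2)
  moreover have "1 - \<i> * z \<noteq> 0"
    using norm_iz by auto
  ultimately show ?thesis
    by (simp add: field_simps)
qed

lemma extremal_class_A_beta:
  assumes \<beta>: "\<beta> \<le> 1"
  shows "extremal \<beta> \<in> class_A_beta \<beta>"
  unfolding class_A_beta_iff
  using extremal_class_A(1)[OF \<beta>]
  by (auto simp: beta_mean_extremal[OF \<beta>] norm_mult simp del: complex_Re_numeral intro!: Re_Moebius_pos)

text \<open>
  \<open>\<i>\<^bsup>2n\<^esup> = - \<i>\<^bsup>2(n-1)\<^esup>\<close>, so the difference of squares is a unimodular multiple of a sum of
  positive numbers.
\<close>
lemma toeplitz_2_extremal:
  assumes \<beta>: "\<beta> \<le> 1" and n: "n \<ge> 2"
  shows "norm (toeplitz_det 2 n (extremal \<beta>)) =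
     4 * (1 / (real n - \<beta> * (real n - 1))\<^sup>2 + 1 / (real n + 1 - real n * \<beta>)\<^sup>2)"
proof -
  define u v where "u = real n - \<beta> * (real n - 1)" and "v = real n + 1 - real n * \<beta>"
  have an: "taylor_coeff (extremal \<beta>) n = 2 * \<i> ^ (n - 1) / of_real u"
    using extremal_class_A(2)[OF \<beta> n] by (simp add: u_def)
  have "taylor_coeff (extremal \<beta>) (n + 1) = 2 * \<i> ^ (n + 1 - 1) / of_real (real (n + 1) - \<beta> * (real (n + 1) - 1))"
    by (rule extremal_class_A(2)[OF \<beta>]) (use n in simp)
  also have "real (n + 1) - \<beta> * (real (n + 1) - 1) = v"
    by (simp add: v_def algebra_simps)
  also have "\<i> ^ (n + 1 - 1) = \<i> * \<i> ^ (n - 1)"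
    using n by (simp flip: power_Suc)
  finally have an1: "taylor_coeff (extremal \<beta>) (n + 1) = 2 * (\<i> * \<i> ^ (n - 1)) / of_real v" .
  have "toeplitz_det 2 n (extremal \<beta>) = (\<i> ^ (n - 1))\<^sup>2 * of_real (4 * (1 / u\<^sup>2 + 1 / v\<^sup>2))"
    unfolding toeplitz_det_2 an an1
    by (simp add: power_divide power_mult_distrib algebra_simps)
  moreover have "0 \<le> 4 * (1 / u\<^sup>2 + 1 / v\<^sup>2)"
    by simp
  ultimately show ?thesis
    by (simp only: norm_mult norm_power norm_of_real u_def v_def) simp
qed

text \<open>
  Here \<open>a\<^sub>2\<^sup>2 = - 4 / (2 - \<beta>)\<^sup>2\<close> and \<open>a\<^sub>3 = - 2 / (3 - 2 \<beta>)\<close>.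
\<close>
lemma toeplitz_3_extremal:
  assumes \<beta>: "0 \<le> \<beta>" "\<beta> \<le> 1"
  shows "norm (toeplitz_det 3 1 (extremal \<beta>)) =
     (4 * \<beta> ^ 4 - 28 * \<beta> ^ 3 + 101 * \<beta>\<^sup>2 - 196 * \<beta> + 140) / ((3 - 2 * \<beta>)\<^sup>2 * (\<beta> - 2)\<^sup>2)"
proof -
  define u v where "u = 2 - \<beta>" and "v = 3 - 2 * \<beta>"
  have uv: "u > 0" "v > 0" using \<beta> by (auto simp: u_def v_def)
  have a2: "taylor_coeff (extremal \<beta>) 2 = 2 * \<i> / of_real u"
    using extremal_class_A(2)[OF \<beta>(2), of 2] by (simp add: u_def)
  have a3: "taylor_coeff (extremal \<beta>) 3 = - 2 / of_real v"
    using extremal_class_A(2)[OF \<beta>(2), of 3] by (simp add: v_def mult.commute)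
  define B where "B = 1 + 8 / u\<^sup>2 + 2 / v * (8 / u\<^sup>2 - 2 / v)"
  have "toeplitz_det 3 1 (extremal \<beta>) = of_real B"
    unfolding toeplitz_det_3_1[OF extremal_class_A(1)[OF \<beta>(2)]] a2 a3 B_def
    using uv by (simp add: power_divide power_mult_distrib) (simp add: power2_eq_square divide_simps)
  (* the upper bound, applied to this very function, spares estimating B from below *)
  moreover have "B \<ge> 0"
  proof -
    have "norm (toeplitz_det 3 1 (extremal \<beta>)) \<le> B"
      using toeplitz_3_bound[OF \<beta> extremal_class_A_beta[OF \<beta>(2)]]
      unfolding B_def u_def v_def by (simp only: toeplitz_3_bound_split[OF \<beta>])
    then show ?thesis by (rule order.trans[OF norm_ge_zero])
  qed
  ultimately have "norm (toeplitz_det 3 1 (extremal \<beta>)) = B" by simp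
  then show ?thesis
    unfolding B_def u_def v_def by (simp only: toeplitz_3_bound_split[OF \<beta>])
qed

theorem theorem3p1:
  fixes \<beta> :: real
  assumes "0 \<le> \<beta>" and "\<beta> \<le> 1"
  shows "(\<forall>n\<ge>2.
            (\<forall>f\<in>class_A_beta \<beta>. norm (toeplitz_det 2 n f) \<le>
               4 * (1 / (real n - \<beta> * (real n - 1))\<^sup>2 + 1 / (real n + 1 - real n * \<beta>)\<^sup>2)) \<and>
            (\<exists>f\<in>class_A_beta \<beta>. norm (toeplitz_det 2 n f) =
               4 * (1 / (real n - \<beta> * (real n - 1))\<^sup>2 + 1 / (real n + 1 - real n * \<beta>)\<^sup>2)))
       \<and> (\<forall>f\<in>class_A_beta \<beta>. norm (toeplitz_det 3 1 f) \<le>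
            (4 * \<beta> ^ 4 - 28 * \<beta> ^ 3 + 101 * \<beta>\<^sup>2 - 196 * \<beta> + 140)
              / ((3 - 2 * \<beta>)\<^sup>2 * (\<beta> - 2)\<^sup>2))
       \<and> (\<exists>f\<in>class_A_beta \<beta>. norm (toeplitz_det 3 1 f) =
            (4 * \<beta> ^ 4 - 28 * \<beta> ^ 3 + 101 * \<beta>\<^sup>2 - 196 * \<beta> + 140)
              / ((3 - 2 * \<beta>)\<^sup>2 * (\<beta> - 2)\<^sup>2))"
  using assms
  by (blast intro: toeplitz_2_bound toeplitz_2_extremal toeplitz_3_bound toeplitz_3_extremal
      extremal_class_A_beta)

end
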